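(* Let $(\theta_t)_{t\ge 0}$ be generated by vanilla (full-batch) gradient descent with learning rates $\eta_t$ on the $L^2$-regularized training loss $\mathcal{L}_{\mathrm{train}}=\mathcal{R}+\lambda f_{\mathrm{reg}}$, and let $\nabla_{t,i}=\frac{d\theta_t}{d\epsilon_i}$ be the exact hypergradient for the $i$-th training sample and $\widetilde{\nabla}_{t,i}$ its Hessian-free approximation, as defined in the context. Assume: 1. The training loss $\mathcal{L}_{\mathrm{train}}$ is twice differentiable. 2. The optimization process converges, that is, $\lim_{t\to\infty}\theta_t=\theta^*$. 3. The empirical risk $\mathcal{R}$ has Lipschitz-continuous gradients with Lipschitz constant $L$: $\left\|\frac{\partial \mathcal{R}(\theta)}{\partial\theta}-\frac{\partial \mathcal{R}(\theta')}{\partial\theta}\right\|_2\le L\|\theta-\theta'\|_2$ for all $\theta,\theta'\in\mathcal{H}$. 4. The sequence of learning rates is non-increasing and lower-bounded by $0$: $\eta_t\ge\eta_{t+1}>0$ for all $t$. 5. $0<\eta_t\lambda<1$ for all $t$. 6. The sequence $\nabla_{t,i}$ is ultimately bounded by a constant $P$; without loss of generality, $\|\nabla_{t,i}\|_2<P$ for all $i$. Then the norm of the approximation error is bounded by $$\left\|\nabla_{t,i}-\widetilde{\nabla}_{t,i}\right\|_2<LP\,\frac{\eta_1}{\eta_t\lambda}.$$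
   Context: The training samples are $z_1,\dots,z_N$, $\mathcal{H}$ is the hypothesis space in which the parameter vector $\theta$ lies, and $\ell(z,\theta)$ is a per-sample loss. With marginal sample weights $\epsilon_1,\dots,\epsilon_N$ (set to zero during training), the empirical risk is $\mathcal{R}(\theta)=\sum_{k=1}^N(1/N+\epsilon_k)\,\ell(z_k,\theta)$, the regularizer is $f_{\mathrm{reg}}(\theta)=\frac12\theta^{\mathsf T}\theta$, and $\mathcal{L}_{\mathrm{train}}(\theta)=\mathcal{R}(\theta)+\lambda f_{\mathrm{reg}}(\theta)$ with regularization coefficient $\lambda$. Vanilla gradient descent is $\theta_t=\theta_{t-1}-\eta_t g_{t-1}$ for $t\ge 1$, where $\eta_t$ is the learning rate at step $t$ and $g_t=\frac{\partial\mathcal{L}_{\mathrm{train}}(\theta_t)}{\partial\theta}$. Write $H_{\mathrm{er},t}=\frac{\partial^2\mathcal{R}(\theta_t)}{\partial\theta^2}$ for the Hessian of the empirical risk at step $t$ and $g_{t,i}=\frac{\partial\ell(z_i,\theta_t)}{\partial\theta}$ for the gradient of the $i$-th sample. The exact hypergradient $\nabla_{t,i}=\frac{d\theta_t}{d\epsilon_i}$ (at $\epsilon_i=0$) satisfies $\nabla_{0,i}=0$ and $$\nabla_{t,i}=\nabla_{t-1,i}-\eta_tH_{\mathrm{er},t-1}\nabla_{t-1,i}-\eta_t\lambda\nabla_{t-1,i}-\eta_tg_{t-1,i},\qquad t\ge 1.$$ The approximation $\widetilde{\nabla}_{t,i}$ is obtained by setting the Hessian in this recurrence to zero: $\widetilde{\nabla}_{0,i}=0$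 and $$\widetilde{\nabla}_{t,i}=\widetilde{\nabla}_{t-1,i}-\eta_t\lambda\widetilde{\nabla}_{t-1,i}-\eta_tg_{t-1,i},\qquad t\ge 1.$$
   Formalization: The Lipschitz constant L is assumed to be strictly positive; for L = 0 (for example, a loss linear in θ) the approximation error is 0 and the strict bound would read 0 < 0. *)

theory Defs
  imports "HOL-Analysis.Analysis"
begin

text \<open>The gradient as a total function. It is meaningful only where \<^term>\<open>f\<close> is differentiable;
  there the \<^term>\<open>D\<close> with \<^prop>\<open>GDERIV f x :> D\<close> is unique.\<close>

definition grad :: "(real ^ 'p \<Rightarrow> real) \<Rightarrow> real ^ 'p \<Rightarrow> real ^ 'p" where
  "grad f x = (THE D. GDERIV f x :> D)"

text \<open>Intended for open \<^term>\<open>S\<close>, since \<^const>\<open>grad\<close> refers to full neighbourhoods.\<close>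

definition twice_differentiable_on :: "(real ^ 'p \<Rightarrow> real) \<Rightarrow> (real ^ 'p) set \<Rightarrow> bool" where
  "twice_differentiable_on f S \<longleftrightarrow> f differentiable_on S \<and> grad f differentiable_on S"

text \<open>Samples \<open>z 1, \<dots>, z N\<close> carry marginal weights \<open>eps 1, \<dots>, eps N\<close>; values of \<^term>\<open>z\<close> and
  \<^term>\<open>eps\<close> outside \<open>{1..N}\<close> are irrelevant. Actual training uses \<open>eps = (\<lambda>_. 0)\<close>.\<close>

definition emp_risk ::
  "('z \<Rightarrow> real ^ 'p \<Rightarrow> real) \<Rightarrow> nat \<Rightarrow> (nat \<Rightarrow> 'z) \<Rightarrow> (nat \<Rightarrow> real) \<Rightarrow> real ^ 'p \<Rightarrow> real" where
  "emp_risk l N z eps x = (\<Sum>k=1..N. (1 / real N + eps k) * l (z k) x)"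

definition f_reg :: "real ^ 'p \<Rightarrow> real" where
  "f_reg x = 1 / 2 * (x \<bullet> x)"

definition train_loss ::
  "('z \<Rightarrow> real ^ 'p \<Rightarrow> real) \<Rightarrow> nat \<Rightarrow> (nat \<Rightarrow> 'z) \<Rightarrow> real \<Rightarrow> (nat \<Rightarrow> real) \<Rightarrow> real ^ 'p \<Rightarrow> real" where
  "train_loss l N z lam eps x = emp_risk l N z eps x + lam * f_reg x"

text \<open>Learning rates are indexed from 1: step \<open>t \<ge> 1\<close> uses \<open>\<eta> t\<close>, and \<open>\<eta> 0\<close> is never used.\<close>

primrec gd_iterate ::
  "(real ^ 'p \<Rightarrow> real) \<Rightarrow> (nat \<Rightarrow> real) \<Rightarrow> real ^ 'p \<Rightarrow> nat \<Rightarrow> real ^ 'p" where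
  "gd_iterate f \<eta> x0 0 = x0"
| "gd_iterate f \<eta> x0 (Suc t) = gd_iterate f \<eta> x0 t - \<eta> (Suc t) *\<^sub>R grad f (gd_iterate f \<eta> x0 t)"

definition theta ::
  "('z \<Rightarrow> real ^ 'p \<Rightarrow> real) \<Rightarrow> nat \<Rightarrow> (nat \<Rightarrow> 'z) \<Rightarrow> real \<Rightarrow> (nat \<Rightarrow> real) \<Rightarrow> real ^ 'p
    \<Rightarrow> (nat \<Rightarrow> real) \<Rightarrow> nat \<Rightarrow> real ^ 'p" where
  "theta l N z lam \<eta> x0 eps t = gd_iterate (train_loss l N z lam eps) \<eta> x0 t"

text \<open>The derivative of the \<open>t\<close>-th iterate with respect to the weight of sample \<open>i\<close>, at zero
  weights. The initial point does not depend on the weights, so this is 0 for \<open>t = 0\<close>.\<close>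

definition hypergrad ::
  "('z \<Rightarrow> real ^ 'p \<Rightarrow> real) \<Rightarrow> nat \<Rightarrow> (nat \<Rightarrow> 'z) \<Rightarrow> real \<Rightarrow> (nat \<Rightarrow> real) \<Rightarrow> real ^ 'p
    \<Rightarrow> nat \<Rightarrow> nat \<Rightarrow> real ^ 'p" where
  "hypergrad l N z lam \<eta> x0 t i =
    vector_derivative (\<lambda>s. theta l N z lam \<eta> x0 ((\<lambda>_. 0)(i := s)) t) (at 0)"

text \<open>The recurrence satisfied by \<^const>\<open>hypergrad\<close>, which is
  \<open>\<nabla>\<^sub>t = \<nabla>\<^sub>t\<^sub>-\<^sub>1 - \<eta>\<^sub>t H\<^sub>t\<^sub>-\<^sub>1 \<nabla>\<^sub>t\<^sub>-\<^sub>1 - \<eta>\<^sub>t lam \<nabla>\<^sub>t\<^sub>-\<^sub>1 - \<eta>\<^sub>t g\<^sub>t\<^sub>-\<^sub>1\<^sub>,\<^sub>i\<close> with \<open>H\<close> the Hessian of the empirical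
  risk, after dropping the term containing \<open>H\<close>.\<close>

primrec hypergrad_approx ::
  "('z \<Rightarrow> real ^ 'p \<Rightarrow> real) \<Rightarrow> nat \<Rightarrow> (nat \<Rightarrow> 'z) \<Rightarrow> real \<Rightarrow> (nat \<Rightarrow> real) \<Rightarrow> real ^ 'p
    \<Rightarrow> nat \<Rightarrow> nat \<Rightarrow> real ^ 'p" where
  "hypergrad_approx l N z lam \<eta> x0 0 i = 0"
| "hypergrad_approx l N z lam \<eta> x0 (Suc t) i =
     hypergrad_approx l N z lam \<eta> x0 t i
     - (\<eta> (Suc t) * lam) *\<^sub>R hypergrad_approx l N z lam \<eta> x0 t i
     - \<eta> (Suc t) *\<^sub>R grad (l (z i)) (theta l N z lam \<eta> x0 (\<lambda>_. 0) t)"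

end

theory Submission
  imports Defs
begin

text \<open>Differentiating one gradient step in the weight of sample \<open>i\<close> yields the exact recurrence;
  for this the perturbed iterates need to stay in the open set \<open>H\<close> only for small weights, which
  follows from their continuity at weight zero. The error \<open>e\<^sub>t\<close> of the approximation then satisfies
  \<open>e\<^sub>t = (1 - \<eta>\<^sub>t lam) e\<^sub>t\<^sub>-\<^sub>1 - \<eta>\<^sub>t H\<^sub>t\<^sub>-\<^sub>1 \<nabla>\<^sub>t\<^sub>-\<^sub>1\<close>, where the Hessian \<open>H\<^sub>t\<^sub>-\<^sub>1\<close> is bounded by the
  Lipschitz constant \<open>L\<close> of the gradient. As \<open>L P / lam\<close> is the fixed point of
  \<open>a \<mapsto> (1 - \<eta>\<^sub>t lam) a + \<eta>\<^sub>t L P\<close>, it bounds all errors, and \<open>\<eta>\<^sub>1 / \<eta>\<^sub>t \<ge> 1\<close>.\<close>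

lemma grad_eqI:
  assumes "GDERIV f x :> D"
  shows "grad f x = D"
  unfolding grad_def
proof (rule the_equality)
  fix D' assume "GDERIV f x :> D'"
  with assms have "(\<lambda>h. inner h D) = (\<lambda>h. inner h D')"
    unfolding gderiv_def by (rule has_derivative_unique)
  then show "D' = D"
    using vector_eq_ldot[of D D'] vector_eq_rdot[of D D'] by (simp add: fun_eq_iff)
qed (fact assms)

lemma GDERIV_grad:
  assumes "f differentiable at x"
  shows "GDERIV f x :> grad f x"
proof -
  obtain f' where f': "(f has_derivative f') (at x)"
    using assms unfolding differentiable_def by blast
  then have "linear f'"
    by (rule has_derivative_linear)
  \<comment> \<open>Riesz representation: the linear functional \<open>f'\<close> is the inner
    product with its adjoint at 1, which supplies the witness for the gradient.\<close>
  then have "(\<lambda>h. inner h (adjoint f' 1)) = f'"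
    by (simp add: adjoint_works)
  with f' have "GDERIV f x :> adjoint f' 1"
    by (simp add: gderiv_def)
  moreover from this have "grad f x = adjoint f' 1"
    by (rule grad_eqI)
  ultimately show ?thesis
    by simp
qed

lemma grad_add_cmult:
  assumes "f differentiable at x" "g differentiable at x"
  shows "grad (\<lambda>y. f y + c * g y) x = grad f x + c *\<^sub>R grad g x"
proof (rule grad_eqI)
  have "((\<lambda>y. f y + c * g y) has_derivative (\<lambda>h. inner h (grad f x) + c * inner h (grad g x))) (at x)"
    using assms[THEN GDERIV_grad] unfolding gderiv_def
    by (intro has_derivative_add has_derivative_mult_right)
  then show "GDERIV (\<lambda>y. f y + c * g y) x :> grad f x + c *\<^sub>R grad g x"
    unfolding gderiv_def by (simp add: inner_add_right)
qed

text \<open>Used with negative \<open>c\<close> to isolate the sample loss and the empirical risk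
  from training losses. Openness turns differentiability on \<open>S\<close> into differentiability
  at its points, where \<open>grad\<close> is meaningful.\<close>

lemma twice_differentiable_on_add_cmult:
  assumes "open S" "twice_differentiable_on f S" "twice_differentiable_on g S"
  shows "twice_differentiable_on (\<lambda>y. f y + c * g y) S"
proof -
  have df: "f differentiable at x" "g differentiable at x" if "x \<in> S" for x
    using assms that unfolding twice_differentiable_on_def
    by (auto simp: differentiable_on_eq_differentiable_at)
  have "(\<lambda>x. grad f x + c *\<^sub>R grad g x) differentiable_on S"
    using assms unfolding twice_differentiable_on_def
    by (auto simp: differentiable_on_def intro!: derivative_intros)
  then have "grad (\<lambda>y. f y + c * g y) differentiable_on S"
    unfolding differentiable_on_def
    by (auto simp: grad_add_cmult df intro: differentiable_transform_within[OF _ zero_less_one])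
  moreover have "(\<lambda>y. f y + c * g y) differentiable_on S"
    using assms unfolding twice_differentiable_on_def
    by (auto simp: differentiable_on_def intro!: derivative_intros)
  ultimately show ?thesis
    unfolding twice_differentiable_on_def by simp
qed

lemma grad_f_reg: "grad f_reg (x :: real ^ 'p) = x"
proof (rule grad_eqI)
  have "((\<lambda>x :: real ^ 'p. 1 / 2 * (x \<bullet> x)) has_derivative (\<lambda>h. inner h x)) (at x)"
    by (auto intro!: derivative_eq_intros simp: inner_commute)
  then show "GDERIV f_reg x :> x"
    unfolding gderiv_def f_reg_def[abs_def] .
qed

lemma twice_differentiable_on_f_reg: "twice_differentiable_on f_reg S"
  unfolding twice_differentiable_on_def
proof
  show "f_reg differentiable_on S"
    unfolding f_reg_def[abs_def] differentiable_on_def by (auto intro!: derivative_intros)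
  show "grad f_reg differentiable_on S"
    by (simp add: grad_f_reg[abs_def] differentiable_on_def)
qed

text \<open>Difference quotients of \<open>g\<close> along the line through \<open>x\<close> in
  direction \<open>v\<close> tend to \<open>A v\<close>, and the Lipschitz condition bounds each of
  them by \<open>L * norm v\<close>. Openness of \<open>S\<close> keeps the line in \<open>S\<close>
  for small \<open>s\<close>.\<close>

lemma norm_derivative_le_lipschitz:
  fixes g :: "'a::real_normed_vector \<Rightarrow> 'b::real_normed_vector"
  assumes "L-lipschitz_on S g" "open S" "x \<in> S" and g: "(g has_derivative A) (at x)"
  shows "norm (A v) \<le> L * norm v"
proof -
  define c where "c = (\<lambda>s::real. x + s *\<^sub>R v)"
  have "(c has_derivative (\<lambda>h. h *\<^sub>R v)) (at 0)"
    unfolding c_def by (auto intro!: derivative_eq_intros)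
  moreover have "(g has_derivative A) (at (c 0))"
    using g by (simp add: c_def)
  ultimately have "((\<lambda>s. g (c s)) has_derivative (\<lambda>h. A (h *\<^sub>R v))) (at 0)"
    by (rule has_derivative_compose)
  then have "((\<lambda>s. g (c s)) has_vector_derivative A v) (at 0)"
    using g[THEN has_derivative_linear]
    by (simp add: has_vector_derivative_def linear_cmul)
  then have lim: "((\<lambda>s. norm (g (c s) - g (c 0) - s *\<^sub>R A v) / norm s) \<longlongrightarrow> 0) (at 0)"
    by (simp add: has_vector_derivative_def has_derivative_iff_norm)
  have "isCont c 0"
    unfolding c_def by (intro continuous_intros)
  have "c 0 \<in> S"
    using assms(3) by (simp add: c_def)
  with \<open>isCont c 0\<close> \<open>open S\<close> have "eventually (\<lambda>s. c s \<in> S) (at 0)"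
    unfolding isCont_def by (intro topological_tendstoD)
  \<comment> \<open>The last summand is the first-order remainder, which vanishes in the limit;
    \<open>s\<close> must be nonzero for the division.\<close>
  then have "eventually (\<lambda>s. norm (A v) \<le>
      L * norm v + norm (g (c s) - g (c 0) - s *\<^sub>R A v) / norm s) (at 0)"
    using eventually_neq_at_within[of 0 0 UNIV]
  proof eventually_elim
    case (elim s)
    have "norm (s *\<^sub>R A v) \<le> norm (g (c s) - g (c 0)) + norm (g (c s) - g (c 0) - s *\<^sub>R A v)"
      using norm_triangle_sub[of "s *\<^sub>R A v" "g (c s) - g (c 0)"] by (simp add: norm_minus_commute)
    also have "norm (g (c s) - g (c 0)) \<le> L * norm (c s - c 0)"
      using lipschitz_onD[OF assms(1) elim(1) \<open>c 0 \<in> S\<close>] by (simp add: dist_norm)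
    finally show ?case
      using elim(2) by (simp add: c_def field_simps)
  qed
  with tendsto_add[OF tendsto_const lim] have "norm (A v) \<le> L * norm v + 0"
    by (rule tendsto_lowerbound) simp
  then show ?thesis
    by simp
qed

text \<open>Brings the perturbed loss into the form \<open>F + s * G\<close>, with only the second
  summand depending on the weight.\<close>

lemma train_loss_upd:
  assumes "i \<in> {1..N}"
  shows "train_loss l N z lam ((\<lambda>_. 0)(i := s)) = (\<lambda>x. train_loss l N z lam (\<lambda>_. 0) x + s * l (z i) x)"
proof
  fix x
  have "(\<Sum>k=1..N. (1 / real N + ((\<lambda>_. 0)(i := s)) k) * l (z k) x)
      = (\<Sum>k=1..N. 1 / real N * l (z k) x + (if k = i then s * l (z i) x else 0))"
    by (intro sum.cong) (auto simp: algebra_simps)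
  also have "\<dots> = (\<Sum>k=1..N. 1 / real N * l (z k) x) + s * l (z i) x"
    using assms by (simp only: sum.distrib) simp
  finally show "train_loss l N z lam ((\<lambda>_. 0)(i := s)) x = train_loss l N z lam (\<lambda>_. 0) x + s * l (z i) x"
    by (simp add: train_loss_def emp_risk_def)
qed

text \<open>Chain and product rule. The Hessian of \<open>G\<close> carries the factor
  \<open>s\<close>, so it drops out at \<open>s = 0\<close> and only the gradient of
  \<open>G\<close> survives.\<close>

lemma has_vector_derivative_gradient_step:
  fixes F G :: "real ^ 'p \<Rightarrow> real"
  assumes "open H" "twice_differentiable_on F H" "twice_differentiable_on G H"
    and c: "(c has_vector_derivative v) (at 0)" and "c 0 \<in> H"
    and A: "(grad F has_derivative A) (at (c 0))"
  shows "((\<lambda>s. c s - a *\<^sub>R grad (\<lambda>y. F y + s * G y) (c s)) has_vector_derivative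
      v - a *\<^sub>R (A v + grad G (c 0))) (at 0)"
proof -
  have df: "F differentiable at x" "G differentiable at x" "grad G differentiable at x"
    if "x \<in> H" for x
    using assms(1-3) that unfolding twice_differentiable_on_def
    by (auto simp: differentiable_on_eq_differentiable_at)
  obtain B where B: "(grad G has_derivative B) (at (c 0))"
    using df(3)[OF \<open>c 0 \<in> H\<close>] unfolding differentiable_def by blast
  have c': "(c has_derivative (\<lambda>h. h *\<^sub>R v)) (at 0)"
    using c by (simp add: has_vector_derivative_def)
  have "((\<lambda>s. c s - a *\<^sub>R (grad F (c s) + s *\<^sub>R grad G (c s))) has_derivative
      (\<lambda>h. h *\<^sub>R v - a *\<^sub>R (A (h *\<^sub>R v) + (0 *\<^sub>R B (h *\<^sub>R v) + h *\<^sub>R grad G (c 0))))) (at 0)"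
    by (intro has_derivative_diff has_derivative_add has_derivative_scaleR_right has_derivative_scaleR
        has_derivative_ident has_derivative_compose[OF c' A] has_derivative_compose[OF c' B] c')
  then have "((\<lambda>s. c s - a *\<^sub>R (grad F (c s) + s *\<^sub>R grad G (c s))) has_derivative
      (\<lambda>h. h *\<^sub>R (v - a *\<^sub>R (A v + grad G (c 0))))) (at 0)"
    using A[THEN has_derivative_linear] by (simp add: linear_cmul algebra_simps)
  \<comment> \<open>The gradient of \<open>F + s * G\<close> is known to split only inside
    \<open>H\<close>, so the two curves are compared near 0 only.\<close>
  moreover have "eventually (\<lambda>s. c s \<in> H) (at 0)"
    using has_derivative_continuous[OF c'] \<open>open H\<close> \<open>c 0 \<in> H\<close>
    unfolding isCont_def by (rule topological_tendstoD)
  then have "eventually (\<lambda>s. c s - a *\<^sub>R (grad F (c s) + s *\<^sub>R grad G (c s))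
      = c s - a *\<^sub>R grad (\<lambda>y. F y + s * G y) (c s)) (at 0)"
    by eventually_elim (simp add: grad_add_cmult df)
  ultimately show ?thesis
    unfolding has_vector_derivative_def
    by (rule has_derivative_transform_eventually) (simp_all add: grad_add_cmult df \<open>c 0 \<in> H\<close>)
qed

theorem theorem1:
  fixes l :: "'z \<Rightarrow> real ^ 'p \<Rightarrow> real" and z :: "nat \<Rightarrow> 'z" and N :: nat
    and H :: "(real ^ 'p) set" and lam L P :: real and \<eta> :: "nat \<Rightarrow> real"
    and x0 x_lim :: "real ^ 'p" and i t :: nat
  assumes "open H"
    and "\<And>t. theta l N z lam \<eta> x0 (\<lambda>_. 0) t \<in> H"
    and "\<And>eps. twice_differentiable_on (train_loss l N z lam eps) H"
    and "(\<lambda>t. theta l N z lam \<eta> x0 (\<lambda>_. 0) t) \<longlonglongrightarrow> x_lim"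
    and "L > 0"
    and "L-lipschitz_on H (grad (emp_risk l N z (\<lambda>_. 0)))"
    and "\<And>t. t \<ge> 1 \<Longrightarrow> \<eta> t \<ge> \<eta> (t + 1) \<and> \<eta> (t + 1) > 0"
    and "\<And>t. t \<ge> 1 \<Longrightarrow> 0 < \<eta> t * lam \<and> \<eta> t * lam < 1"
    and "\<And>t j. j \<in> {1..N} \<Longrightarrow> norm (hypergrad l N z lam \<eta> x0 t j) < P"
    and "i \<in> {1..N}"
    and "t \<ge> 1"
  shows "norm (hypergrad l N z lam \<eta> x0 t i - hypergrad_approx l N z lam \<eta> x0 t i)
    < L * P * (\<eta> 1 / (\<eta> t * lam))"
proof -
  let ?F = "train_loss l N z lam (\<lambda>_. 0)" and ?R = "emp_risk l N z (\<lambda>_. 0)" and ?G = "l (z i)"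
  let ?c = "\<lambda>t s. theta l N z lam \<eta> x0 ((\<lambda>_. 0)(i := s)) t"
  let ?x = "theta l N z lam \<eta> x0 (\<lambda>_. 0)"
  let ?d = "\<lambda>t. hypergrad l N z lam \<eta> x0 t i" and ?a = "\<lambda>t. hypergrad_approx l N z lam \<eta> x0 t i"
  note upd = train_loss_upd[OF assms(10), of l z lam]
  have F: "twice_differentiable_on ?F H"
    by (rule assms(3))
  \<comment> \<open>Smoothness is assumed for training losses only; the loss with weight 1 on sample
    \<open>i\<close> minus the unperturbed one is exactly \<open>?G\<close>.\<close>
  have G: "twice_differentiable_on ?G H"
    using twice_differentiable_on_add_cmult[OF assms(1) assms(3)[of "(\<lambda>_. 0)(i := 1)"] F, of "-1"]
    unfolding upd by simp
  have R: "twice_differentiable_on ?R H"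
    using twice_differentiable_on_add_cmult[OF assms(1) F twice_differentiable_on_f_reg, of "-lam"]
    unfolding train_loss_def by simp
  have c0: "?c t 0 = ?x t" for t
    by (simp add: fun_upd_idem)
  \<comment> \<open>\<open>A t\<close> will be the Hessian of the empirical risk at the
    \<open>t\<close>-th unperturbed iterate.\<close>
  have "\<exists>A. (grad ?R has_derivative A) (at (?x t))" for t
    using R assms(1,2) unfolding twice_differentiable_on_def
    by (auto simp: differentiable_on_eq_differentiable_at differentiable_def)
  then obtain A where A: "\<And>t. (grad ?R has_derivative A t) (at (?x t))"
    by metis
  have gradF: "(grad ?F has_derivative (\<lambda>h. A t h + lam *\<^sub>R h)) (at (?x t))" for t
  proof -
    have "((\<lambda>x. grad ?R x + lam *\<^sub>R x) has_derivative (\<lambda>h. A t h + lam *\<^sub>R h)) (at (?x t))"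
      by (intro has_derivative_add has_derivative_scaleR_right has_derivative_ident A)
    moreover have "grad ?R x + lam *\<^sub>R x = grad ?F x" if "x \<in> H" for x
    proof -
      have "?R differentiable at x" "f_reg differentiable at x"
        using R twice_differentiable_on_f_reg[of H] assms(1) that
        unfolding twice_differentiable_on_def
        by (auto simp: differentiable_on_eq_differentiable_at)
      from grad_add_cmult[OF this, of lam] show ?thesis
        unfolding train_loss_def[abs_def] by (simp add: grad_f_reg)
    qed
    ultimately show ?thesis
      by (rule has_derivative_transform_within_open[OF _ assms(1,2)])
  qed
  have step: "(?c (Suc t) has_vector_derivative
      v - \<eta> (Suc t) *\<^sub>R (A t v + lam *\<^sub>R v + grad ?G (?x t))) (at 0)"
    if "(?c t has_vector_derivative v) (at 0)" for t v
    using has_vector_derivative_gradient_step[OF assms(1) F G that, unfolded c0,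
        OF assms(2) gradF, of "\<eta> (Suc t)"]
    by (simp add: theta_def upd)
  \<comment> \<open>\<open>hypergrad\<close> is a total \<open>vector_derivative\<close>, so
    differentiability of every iterate in the weight has to be established before its recurrence can
    be read off.\<close>
  have "\<exists>v. (?c t has_vector_derivative v) (at 0)" for t
  proof (induction t)
    case 0
    show ?case
      by (auto simp: theta_def intro: has_vector_derivative_const)
  next
    case (Suc t)
    then show ?case
      using step by blast
  qed
  then have d: "(?c t has_vector_derivative ?d t) (at 0)" for t
    unfolding hypergrad_def by (metis vector_derivative_at)
  have d_Suc: "?d (Suc t) = ?d t - \<eta> (Suc t) *\<^sub>R (A t (?d t) + lam *\<^sub>R ?d t + grad ?G (?x t))" for t
    using step[OF d] unfolding hypergrad_def by (rule vector_derivative_at)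
  have d_0: "?d 0 = 0"
    by (simp add: hypergrad_def theta_def)
  \<comment> \<open>Positivity is assumed at \<open>t + 1\<close>; monotonicity carries it back to
    \<open>t\<close>, which covers index 1.\<close>
  have eta_pos: "\<eta> t > 0" if "t \<ge> 1" for t
    using assms(7)[OF that] by linarith
  have lam: "lam > 0"
    using assms(8)[of 1] eta_pos[of 1] by (simp add: zero_less_mult_iff)
  have P: "P > 0"
    using assms(9)[OF assms(10), of 0] norm_ge_zero by (rule le_less_trans[rotated])
  have error: "norm (?d t - ?a t) < L * P / lam" for t
  proof (induction t)
    case 0
    show ?case
      using P lam \<open>L > 0\<close> by (simp add: d_0)
  next
    case (Suc t)
    let ?e = "\<eta> (Suc t)"
    have e: "?e > 0" "?e * lam < 1"
      using eta_pos[of "Suc t"] assms(8)[of "Suc t"] by simp_all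
    \<comment> \<open>The sample gradients cancel, and the Hessian acts on the exact hypergradient
      rather than on the error, so the bound \<open>P\<close> applies to it.\<close>
    have "?d (Suc t) - ?a (Suc t) = (1 - ?e * lam) *\<^sub>R (?d t - ?a t) - ?e *\<^sub>R A t (?d t)"
      by (simp add: d_Suc algebra_simps)
    also have "norm \<dots> \<le> (1 - ?e * lam) * norm (?d t - ?a t) + ?e * norm (A t (?d t))"
      using e by (intro order_trans[OF norm_triangle_ineq4]) simp
    \<comment> \<open>Strictness comes from the induction hypothesis, since its factor
      \<open>1 - ?e * lam\<close> is positive; the Hessian term is bounded only weakly.\<close>
    also have "\<dots> < (1 - ?e * lam) * (L * P / lam) + ?e * (L * P)"
    proof (intro add_less_le_mono mult_strict_left_mono mult_left_mono)
      have "norm (A t (?d t)) \<le> L * norm (?d t)"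
        by (rule norm_derivative_le_lipschitz[OF assms(6,1,2) A])
      also have "\<dots> \<le> L * P"
        using assms(9)[OF assms(10), of t] \<open>L > 0\<close> by simp
      finally show "norm (A t (?d t)) \<le> L * P" .
    qed (use e Suc in auto)
    also have "\<dots> = L * P / lam"
      using lam by (simp add: field_simps)
    finally show ?case .
  qed
  have "\<eta> t \<le> \<eta> 1"
    using assms(11) by (induction t rule: dec_induct) (use assms(7) in force)+
  then have "L * P / lam * 1 \<le> L * P / lam * (\<eta> 1 / \<eta> t)"
    using P lam \<open>L > 0\<close> eta_pos[OF assms(11)] by (intro mult_left_mono) simp_all
  with error[of t] show ?thesis
    by (simp add: mult.commute)
qed

end
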